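(* Let $\mathcal{V}$ be a finite vocabulary and $\mathcal{M} = \{1,\dots,M\}$ a set of workers with weights $w_i \ge 0$, $\sum_{i\in\mathcal{M}} w_i = 1$. At decoding step $t$, let $\mathbf{q}_t = [q_t(x)]_{x\in\mathcal{V}}$ be the probability distribution on $\mathcal{V}$ of the draft model, let $\mathbf{p}_{t,i} = [p_{t,i}(x)]_{x\in\mathcal{V}}$ be the probability distribution on $\mathcal{V}$ produced by worker $i$, let $\mathbf{k} = [k_1,\dots,k_M]$ with $1\le k_i<|\mathcal{V}|$, let $\mathcal{V}^{(k_i)}\subset\mathcal{V}$ be a set of $k_i$ tokens with the highest probabilities under $\mathbf{p}_{t,i}$, and let $\epsilon_{t,i}^{(k_i)} = \sum_{v\notin\mathcal{V}^{(k_i)}} p_{t,i}(v)$. Let $\mathbf{p}^{(k_i)}_{t,i}$ be the reconstructed distribution of worker $i$ under either of the two reconstruction schemes (renormalized top-$K$ reconstruction or residual-mass redistribution), and put $\bar{\mathbf{p}}_t = \sum_{i\in\mathcal{M}} w_i \mathbf{p}_{t,i}$, $\bar{\mathbf{p}}^{(\mathbf{k})}_t = \sum_{i\in\mathcal{M}} w_i \mathbf{p}^{(k_i)}_{t,i}$ and $\Delta^{(\mathbf{k})}_t = \|\bar{\mathbf{p}}^{(\mathbf{k})}_t - \bar{\mathbf{p}}_t\|_1$. Let $\alpha_t$ and $\alpha_t^{(\mathbf{k})}$ be the expected acceptance rates without and with top-$K$ compressed transmission, respectively. Then the acceptance rate variation $\Delta\alpha_t^{(\mathbf{k})} = |\alpha_t^{(\mathbf{k})}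 - \alpha_t|$ satisfies $$\Delta\alpha_t^{(\mathbf{k})} \le \frac{1}{2}\Delta^{(\mathbf{k})}_t \le \sum_{i\in\mathcal{M}} w_i\, \epsilon_{t,i}^{(k_i)}.$$
   Context: $\|\cdot\|_1$ is the $\ell_1$ norm on $\mathbb{R}^{|\mathcal{V}|}$. In speculative decoding, a draft token $x_t\sim\mathbf{q}_t$ is verified against the aggregated distribution $\bar{\mathbf{p}}_t$ and accepted with probability $\min(\bar p_t(x_t)/q_t(x_t), 1)$; the expected acceptance rate is $$\alpha_t = \mathbb{E}_{x\sim\mathbf{q}_t}\left[\min\left(\frac{\bar p_t(x)}{q_t(x)}, 1\right)\right] = \sum_{x\in\mathcal{V}} \min(\bar p_t(x), q_t(x)).$$ With compressed transmission, $\bar{\mathbf{p}}_t$ is replaced by $\bar{\mathbf{p}}^{(\mathbf{k})}_t$, so $\alpha_t^{(\mathbf{k})} = \sum_{x\in\mathcal{V}} \min(\bar p^{(\mathbf{k})}_t(x), q_t(x))$. For each worker $i$, the set $\mathcal{V}^{(k_i)}$ (which depends on $\mathbf{p}_{t,i}$) consists of $k_i$ tokens of largest probability under $\mathbf{p}_{t,i}$ (ties broken arbitrarily), i.e. $|\mathcal{V}^{(k_i)}| = k_i$ and $p_{t,i}(x) \ge p_{t,i}(y)$ for all $x\in\mathcal{V}^{(k_i)}$, $y\notin\mathcal{V}^{(k_i)}$. The retained mass is $\rho_{t,i} = \sum_{v\in\mathcal{V}^{(k_i)}} p_{t,i}(v)$ and the residual mass is $\epsilon_{t,i} = \epsilon_{t,i}^{(k_i)}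 = \sum_{v\notin\mathcal{V}^{(k_i)}} p_{t,i}(v) = 1-\rho_{t,i}$. Renormalized top-$K$ reconstruction: $p^{(k_i)}_{t,i}(x) = p_{t,i}(x)/\rho_{t,i}$ for $x\in\mathcal{V}^{(k_i)}$, and $p^{(k_i)}_{t,i}(x) = 0$ for $x\notin\mathcal{V}^{(k_i)}$. Residual-mass redistribution: $p^{(k_i)}_{t,i}(x) = p_{t,i}(x)$ for $x\in\mathcal{V}^{(k_i)}$, and $p^{(k_i)}_{t,i}(x) = \dfrac{\epsilon_{t,i}}{|\mathcal{V}|-k_i}$ for $x\notin\mathcal{V}^{(k_i)}$. *)

theory Defs
  imports "HOL-Probability.Probability_Mass_Function"
begin

(* The vocabulary is a finite type 'v, and a vector in R^|V| is a function on it.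
   The distributions q and p_i are pmfs. Reconstructed and aggregated distributions are only
   used through their entries, so they are plain real vectors. *)

definition l1_norm :: "('v::finite \<Rightarrow> real) \<Rightarrow> real" where
  "l1_norm f = (\<Sum>x\<in>UNIV. \<bar>f x\<bar>)"

definition aggregate :: "nat \<Rightarrow> (nat \<Rightarrow> real) \<Rightarrow> (nat \<Rightarrow> 'v \<Rightarrow> real) \<Rightarrow> 'v \<Rightarrow> real" where
  "aggregate M w r x = (\<Sum>i\<in>{1..M}. w i * r i x)"

(* The junk value of r x / pmf q x at pmf q x = 0 carries no mass under q. *)
definition acceptance_rate :: "'v pmf \<Rightarrow> ('v \<Rightarrow> real) \<Rightarrow> real" where
  "acceptance_rate q r = measure_pmf.expectation q (\<lambda>x. min (r x / pmf q x) 1)"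

(* A relation rather than a function, so that ties may be broken arbitrarily. *)
definition is_top_k :: "'v::finite pmf \<Rightarrow> nat \<Rightarrow> 'v set \<Rightarrow> bool" where
  "is_top_k p k S \<longleftrightarrow> card S = k \<and> (\<forall>x\<in>S. \<forall>y. y \<notin> S \<longrightarrow> pmf p x \<ge> pmf p y)"

definition retained_mass :: "'v::finite pmf \<Rightarrow> 'v set \<Rightarrow> real" where
  "retained_mass p S = (\<Sum>v\<in>S. pmf p v)"

definition residual_mass :: "'v::finite pmf \<Rightarrow> 'v set \<Rightarrow> real" where
  "residual_mass p S = (\<Sum>v\<in>- S. pmf p v)"

definition renormalized_top_k :: "'v::finite pmf \<Rightarrow> 'v set \<Rightarrow> 'v \<Rightarrow> real" where
  "renormalized_top_k p S x = (if x \<in> S then pmf p x / retained_mass p S else 0)"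

definition residual_redistribution :: "'v::finite pmf \<Rightarrow> nat \<Rightarrow> 'v set \<Rightarrow> 'v \<Rightarrow> real" where
  "residual_redistribution p k S x =
     (if x \<in> S then pmf p x else residual_mass p S / (real CARD('v) - real k))"

lemma acceptance_rate_eq_sum_min:
  fixes q :: "'v::finite pmf"
  assumes "\<And>x. r x \<ge> 0"
  shows "acceptance_rate q r = (\<Sum>x\<in>UNIV. min (r x) (pmf q x))"
proof -
  have "pmf q x * min (r x / pmf q x) 1 = min (r x) (pmf q x)" for x
    using assms[of x] pmf_nonneg[of q x]
    by (cases "pmf q x = 0") (auto simp: min_def field_simps)
  then show ?thesis
    unfolding acceptance_rate_def by (subst integral_measure_pmf_real[of UNIV]) (auto simp: mult.commute)
qed

end

theory Submission
  imports Defs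
begin

text \<open>
  Since min a b = (a + b - |a - b|) / 2, acceptance rates of distributions differ by half the
  difference of two l1 distances to q; this is where the factor 1/2 comes from. For the second
  bound, both reconstructions are probability vectors r that dominate p on the retained set S.
  Hence the excess of p over r lives outside S and has mass at most the residual mass, and the l1
  distance between two vectors of equal total mass is twice that excess.
\<close>

lemma sum_pmf_UNIV [simp]: "(\<Sum>x\<in>UNIV. pmf (p :: 'v::finite pmf) x) = 1"
  by (rule sum_pmf_eq_1) auto

lemma retained_plus_residual: "retained_mass p S + residual_mass p S = 1"
proof -
  have "(\<Sum>x\<in>S. pmf p x) + (\<Sum>x\<in>- S. pmf p x) = (\<Sum>x\<in>UNIV. pmf p x)"
    by (subst sum.union_disjoint [symmetric]) auto
  then show ?thesis
    by (simp add: retained_mass_def residual_mass_def)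
qed

lemma retained_mass_nonneg: "retained_mass p S \<ge> 0"
  by (simp add: retained_mass_def sum_nonneg)

lemma residual_mass_nonneg: "residual_mass p S \<ge> 0"
  by (simp add: residual_mass_def sum_nonneg)

text \<open>Justifies the division in \<open>renormalized_top_k\<close>. Since \<open>k\<close> is
  at least 1, \<open>S\<close> has an element; if \<open>S\<close> carried no mass, that element
  would have probability 0 and still dominate every token outside \<open>S\<close>, so
  \<open>p\<close> would vanish everywhere, against total mass 1.\<close>

lemma retained_mass_pos:
  assumes "is_top_k p k S" "k \<ge> 1"
  shows "retained_mass p S > 0"
proof (rule ccontr)
  assume "\<not> retained_mass p S > 0"
  with retained_mass_nonneg[of p S] have 0: "retained_mass p S = 0"
    by linarith
  then have in0: "pmf p x = 0" if "x \<in> S" for x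
    using that by (simp add: retained_mass_def sum_nonneg_eq_0_iff)
  obtain x where "x \<in> S"
    using assms by (cases "S = {}") (auto simp: is_top_k_def)
  with assms in0 have "pmf p y \<le> 0" if "y \<notin> S" for y
    using that by (metis is_top_k_def)
  then have "residual_mass p S \<le> 0"
    by (auto simp: residual_mass_def intro: sum_nonpos)
  with 0 retained_plus_residual[of p S] show False
    by linarith
qed

text \<open>Reconstructions and aggregates are plain functions, not pmfs. This predicate covers both
  schemes, the original distributions and their mixtures uniformly.\<close>

definition prob_vector :: "('v::finite \<Rightarrow> real) \<Rightarrow> bool" where
  "prob_vector r \<longleftrightarrow> (\<forall>x. r x \<ge> 0) \<and> (\<Sum>x\<in>UNIV. r x) = 1"

lemma prob_vector_pmf: "prob_vector (pmf p)"
  by (simp add: prob_vector_def)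

lemma prob_vector_renormalized_top_k:
  assumes "retained_mass p S > 0"
  shows "prob_vector (renormalized_top_k p S)"
proof -
  have "(\<Sum>x\<in>UNIV. renormalized_top_k p S x) = (\<Sum>x\<in>S. pmf p x / retained_mass p S)"
    by (simp add: renormalized_top_k_def sum.If_cases)
  also have "\<dots> = 1"
    using assms by (simp add: sum_divide_distrib [symmetric] retained_mass_def)
  finally show ?thesis
    using assms by (simp add: prob_vector_def renormalized_top_k_def)
qed

text \<open>Dividing by a retained mass that is at most 1 can only enlarge an entry.\<close>

lemma renormalized_top_k_ge:
  assumes "retained_mass p S > 0" "x \<in> S"
  shows "renormalized_top_k p S x \<ge> pmf p x"
proof -
  have "retained_mass p S \<le> 1"
    using retained_plus_residual[of p S] residual_mass_nonneg[of p S] by linarith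
  then have "pmf p x * retained_mass p S \<le> pmf p x"
    by (simp add: mult_left_le)
  with assms show ?thesis
    by (simp add: renormalized_top_k_def pos_le_divide_eq)
qed

lemma prob_vector_residual_redistribution:
  fixes p :: "'v::finite pmf"
  assumes "card S = k" "k < CARD('v)"
  shows "prob_vector (residual_redistribution p k S)"
proof -
  \<comment> \<open>The denominator of the uniform share counts the tokens receiving it and is
    nonzero because \<open>k < CARD('v)\<close>, so the shares add up to exactly the residual
    mass.\<close>
  have "real (card (- S)) = real CARD('v) - real k"
    using assms by (simp add: Compl_eq_Diff_UNIV card_Diff_subset of_nat_diff)
  then have "(\<Sum>x\<in>UNIV. residual_redistribution p k S x) = retained_mass p S + residual_mass p S"
    using assms by (simp add: residual_redistribution_def sum.If_cases retained_mass_def)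
  with assms show ?thesis
    by (simp add: prob_vector_def residual_redistribution_def retained_plus_residual
        residual_mass_nonneg)
qed

text \<open>Stated for any probability vector dominating \<open>p\<close> on \<open>S\<close>, so
  that one argument serves both reconstruction schemes.\<close>

lemma l1_norm_le_residual_mass:
  assumes r: "prob_vector r" and ge: "\<And>x. x \<in> S \<Longrightarrow> r x \<ge> pmf p x"
  shows "l1_norm (\<lambda>x. r x - pmf p x) \<le> 2 * residual_mass p S"
proof -
  \<comment> \<open>An absolute value is the number plus twice its negative part. That part is 0 on
    \<open>S\<close> by domination and at most \<open>pmf p x\<close> elsewhere, as
    \<open>r x\<close> is nonnegative. The signed differences cancel on summation.\<close>
  have "\<bar>r x - pmf p x\<bar> \<le> (r x - pmf p x) + (if x \<in> S then 0 else 2 * pmf p x)" for x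
    using r ge[of x] pmf_nonneg[of p x] by (auto simp: prob_vector_def abs_if)
  then have "l1_norm (\<lambda>x. r x - pmf p x)
      \<le> (\<Sum>x\<in>UNIV. (r x - pmf p x) + (if x \<in> S then 0 else 2 * pmf p x))"
    unfolding l1_norm_def by (intro sum_mono)
  also have "\<dots> = 2 * residual_mass p S"
    using r by (simp add: prob_vector_def sum.distrib sum_subtractf sum.If_cases residual_mass_def
        sum_distrib_left)
  finally show ?thesis .
qed

lemma prob_vector_aggregate:
  assumes "\<And>i. i \<in> {1..M} \<Longrightarrow> w i \<ge> 0" "(\<Sum>i\<in>{1..M}. w i) = 1"
    and "\<And>i. i \<in> {1..M} \<Longrightarrow> prob_vector (r i)"
  shows "prob_vector (aggregate M w r)"
proof -
  have "(\<Sum>x\<in>UNIV. aggregate M w r x) = (\<Sum>i\<in>{1..M}. \<Sum>x\<in>UNIV. w i * r i x)"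
    unfolding aggregate_def by (rule sum.swap)
  also have "\<dots> = (\<Sum>i\<in>{1..M}. w i)"
    using assms(3) by (intro sum.cong) (auto simp: prob_vector_def simp flip: sum_distrib_left)
  finally show ?thesis
    using assms by (auto simp: prob_vector_def aggregate_def intro!: sum_nonneg)
qed

lemma l1_norm_aggregate_diff_le:
  assumes "\<And>i. i \<in> {1..M} \<Longrightarrow> w i \<ge> 0"
  shows "l1_norm (\<lambda>x. aggregate M w r x - aggregate M w s x)
           \<le> (\<Sum>i\<in>{1..M}. w i * l1_norm (\<lambda>x. r i x - s i x))"
proof -
  have "\<bar>aggregate M w r x - aggregate M w s x\<bar> \<le> (\<Sum>i\<in>{1..M}. w i * \<bar>r i x - s i x\<bar>)" for x
  proof -
    have "aggregate M w r x - aggregate M w s x = (\<Sum>i\<in>{1..M}. w i * (r i x - s i x))"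
      by (simp add: aggregate_def sum_subtractf right_diff_distrib)
    also have "\<bar>\<dots>\<bar> \<le> (\<Sum>i\<in>{1..M}. \<bar>w i * (r i x - s i x)\<bar>)"
      by (rule sum_abs)
    also have "\<dots> = (\<Sum>i\<in>{1..M}. w i * \<bar>r i x - s i x\<bar>)"
      using assms by (intro sum.cong) (auto simp: abs_mult)
    finally show ?thesis .
  qed
  then have "l1_norm (\<lambda>x. aggregate M w r x - aggregate M w s x)
      \<le> (\<Sum>x\<in>UNIV. \<Sum>i\<in>{1..M}. w i * \<bar>r i x - s i x\<bar>)"
    unfolding l1_norm_def by (intro sum_mono)
  also have "\<dots> = (\<Sum>i\<in>{1..M}. w i * l1_norm (\<lambda>x. r i x - s i x))"
    unfolding l1_norm_def sum_distrib_left by (rule sum.swap)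
  finally show ?thesis .
qed

text \<open>The acceptance rate is one minus the total variation distance to the draft distribution.
  The constant 1 is half the combined mass of \<open>r\<close> and \<open>q\<close>.\<close>

lemma acceptance_rate_eq_l1_norm:
  assumes "prob_vector r"
  shows "acceptance_rate q r = 1 - 1 / 2 * l1_norm (\<lambda>x. r x - pmf q x)"
proof -
  have "acceptance_rate q r = (\<Sum>x\<in>UNIV. min (r x) (pmf q x))"
    using assms by (intro acceptance_rate_eq_sum_min) (simp add: prob_vector_def)
  also have "\<dots> = (\<Sum>x\<in>UNIV. (r x + pmf q x - \<bar>r x - pmf q x\<bar>) / 2)"
    by (intro sum.cong) (auto simp: min_def abs_if)
  also have "\<dots> = 1 - 1 / 2 * l1_norm (\<lambda>x. r x - pmf q x)"
    using assms
    by (simp add: prob_vector_def l1_norm_def sum.distrib sum_subtractf diff_divide_distrib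
        flip: sum_divide_distrib)
  finally show ?thesis .
qed

lemma l1_norm_triangle: "l1_norm (\<lambda>x. f x - h x) \<le> l1_norm (\<lambda>x. f x - g x) + l1_norm (\<lambda>x. g x - h x)"
  unfolding l1_norm_def sum.distrib [symmetric] by (intro sum_mono) linarith

lemma l1_norm_minus_commute: "l1_norm (\<lambda>x. f x - g x) = l1_norm (\<lambda>x. g x - f x)"
  by (simp add: l1_norm_def abs_minus_commute)

text \<open>A reverse triangle inequality for the distances to \<open>q\<close>: each of the two
  triangle instances bounds one sign of the difference.\<close>

lemma acceptance_rate_variation_le:
  assumes "prob_vector r" "prob_vector s"
  shows "\<bar>acceptance_rate q r - acceptance_rate q s\<bar> \<le> 1 / 2 * l1_norm (\<lambda>x. r x - s x)"
  using l1_norm_triangle[of r "pmf q" s] l1_norm_triangle[of s "pmf q" r]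
    l1_norm_minus_commute[of r s]
  unfolding acceptance_rate_eq_l1_norm[OF assms(1)] acceptance_rate_eq_l1_norm[OF assms(2)]
  by linarith

theorem theorem3:
  fixes M :: nat
    and w :: "nat \<Rightarrow> real"
    and q :: "'v::finite pmf"
    and p :: "nat \<Rightarrow> 'v pmf"
    and k :: "nat \<Rightarrow> nat"
    and S :: "nat \<Rightarrow> 'v set"
    and p_rec :: "nat \<Rightarrow> 'v \<Rightarrow> real"
  defines "p_bar \<equiv> aggregate M w (\<lambda>i. pmf (p i))"
    and "p_bar_k \<equiv> aggregate M w p_rec"
  assumes weights_nonneg: "\<And>i. i \<in> {1..M} \<Longrightarrow> w i \<ge> 0"
    and weights_sum: "(\<Sum>i\<in>{1..M}. w i) = 1"
    and k_bounds: "\<And>i. i \<in> {1..M} \<Longrightarrow> 1 \<le> k i \<and> k i < CARD('v)"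
    and top_k: "\<And>i. i \<in> {1..M} \<Longrightarrow> is_top_k (p i) (k i) (S i)"
    and reconstruction: "\<And>i. i \<in> {1..M} \<Longrightarrow>
          p_rec i = renormalized_top_k (p i) (S i) \<or>
          p_rec i = residual_redistribution (p i) (k i) (S i)"
  shows "\<bar>acceptance_rate q p_bar_k - acceptance_rate q p_bar\<bar>
           \<le> 1 / 2 * l1_norm (\<lambda>x. p_bar_k x - p_bar x)
       \<and> 1 / 2 * l1_norm (\<lambda>x. p_bar_k x - p_bar x)
           \<le> (\<Sum>i\<in>{1..M}. w i * residual_mass (p i) (S i))"
proof -
  \<comment> \<open>The choice of scheme matters only for these two facts; the rest of the argument
    treats all workers alike, even if they use different schemes.\<close>
  have rec: "prob_vector (p_rec i)"
    "l1_norm (\<lambda>x. p_rec i x - pmf (p i) x) \<le> 2 * residual_mass (p i) (S i)"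
    if i: "i \<in> {1..M}" for i
  proof -
    have pos: "retained_mass (p i) (S i) > 0"
      using retained_mass_pos top_k[OF i] k_bounds[OF i] by blast
    have "card (S i) = k i"
      using top_k[OF i] by (simp add: is_top_k_def)
    with pos show pv: "prob_vector (p_rec i)"
      using reconstruction[OF i] k_bounds[OF i] prob_vector_renormalized_top_k
        prob_vector_residual_redistribution by metis
    \<comment> \<open>Redistribution leaves the entries on \<open>S i\<close> unchanged, so equality
      holds there; renormalization enlarges them.\<close>
    have "p_rec i x \<ge> pmf (p i) x" if "x \<in> S i" for x
      using reconstruction[OF i] renormalized_top_k_ge[OF pos that] that
      by (auto simp: residual_redistribution_def)
    with pv show "l1_norm (\<lambda>x. p_rec i x - pmf (p i) x) \<le> 2 * residual_mass (p i) (S i)"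
      by (rule l1_norm_le_residual_mass)
  qed
  have "prob_vector p_bar" "prob_vector p_bar_k"
    unfolding p_bar_def p_bar_k_def
    using weights_nonneg weights_sum rec(1) prob_vector_pmf
    by (auto intro!: prob_vector_aggregate)
  then have "\<bar>acceptance_rate q p_bar_k - acceptance_rate q p_bar\<bar>
      \<le> 1 / 2 * l1_norm (\<lambda>x. p_bar_k x - p_bar x)"
    by (intro acceptance_rate_variation_le)
  moreover have "l1_norm (\<lambda>x. p_bar_k x - p_bar x)
      \<le> (\<Sum>i\<in>{1..M}. w i * l1_norm (\<lambda>x. p_rec i x - pmf (p i) x))"
    unfolding p_bar_def p_bar_k_def using weights_nonneg by (rule l1_norm_aggregate_diff_le)
  moreover have "\<dots> \<le> (\<Sum>i\<in>{1..M}. w i * (2 * residual_mass (p i) (S i)))"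
    using weights_nonneg rec(2) by (intro sum_mono mult_left_mono)
  moreover have "\<dots> = 2 * (\<Sum>i\<in>{1..M}. w i * residual_mass (p i) (S i))"
    by (simp add: sum_distrib_left mult.left_commute)
  ultimately show ?thesis
    by linarith
qed

end
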